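(* Let $G$ be a finite supersolvable group. Then $\gamma(G)\neq 2$ if and only if $G$ is nilpotent.
   Context: For a finite group $G$, a normal $k$-covering of $G$ is a collection of $k$ proper subgroups $H_1,\dots,H_k$ of $G$ with $G=\bigcup_{i=1}^k\bigcup_{g\in G}H_i^g$. The normal covering number $\gamma(G)$ is the smallest $k$ such that $G$ admits a normal $k$-covering. If $G$ admits no normal $k$-covering for any $k$ (that is, $G$ is cyclic), then $\gamma(G)\neq 2$. By Jordan's theorem no finite group is the union of the conjugates of a single proper subgroup, so $\gamma(G)=2$ if and only if there exist two proper subgroups $H,K<G$ with $G=\bigcup_{g\in G}H^g\cup\bigcup_{g\in G}K^g$. *)

theory Defs
  imports "HOL-Algebra.Elementary_Groups" "HOL-Library.Extended_Nat"
begin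

definition group_center :: "('a, 'b) monoid_scheme \<Rightarrow> 'a set" where
  "group_center G = {z \<in> carrier G. \<forall>g\<in>carrier G. z \<otimes>\<^bsub>G\<^esub> g = g \<otimes>\<^bsub>G\<^esub> z}"

text \<open>Existence of a finite central series: each \<open>N (i + 1) / N i\<close> lies in the center of \<open>G / N i\<close>.\<close>

definition nilpotent_group :: "('a, 'b) monoid_scheme \<Rightarrow> bool" where
  "nilpotent_group G \<longleftrightarrow>
     (\<exists>n (N :: nat \<Rightarrow> 'a set). N 0 = {\<one>\<^bsub>G\<^esub>} \<and> N n = carrier G \<and> (\<forall>i\<le>n. N i \<lhd> G) \<and>
        (\<forall>i<n. N i \<subseteq> N (Suc i) \<and>
           carrier ((G\<lparr>carrier := N (Suc i)\<rparr>) Mod N i) \<subseteq> group_center (G Mod N i)))"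

text \<open>All terms of the series are normal in the whole group \<open>G\<close>; a subnormal series with cyclic
  factors would only give polycyclic (for finite groups: solvable) groups.\<close>

definition supersolvable_group :: "('a, 'b) monoid_scheme \<Rightarrow> bool" where
  "supersolvable_group G \<longleftrightarrow>
     (\<exists>n (N :: nat \<Rightarrow> 'a set). N 0 = {\<one>\<^bsub>G\<^esub>} \<and> N n = carrier G \<and> (\<forall>i\<le>n. N i \<lhd> G) \<and>
        (\<forall>i<n. N i \<subseteq> N (Suc i) \<and> cyclic_group ((G\<lparr>carrier := N (Suc i)\<rparr>) Mod N i)))"

definition conjugate_subgroup :: "('a, 'b) monoid_scheme \<Rightarrow> 'a set \<Rightarrow> 'a \<Rightarrow> 'a set" where
  "conjugate_subgroup G H g = inv\<^bsub>G\<^esub> g <#\<^bsub>G\<^esub> H #>\<^bsub>G\<^esub> g"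

text \<open>The components form an indexed family \<open>H 1, \<dots>, H k\<close>, so repetitions are allowed; a covering
  of minimal length has none. The values of \<open>H\<close> outside \<open>{1..k}\<close> are irrelevant.\<close>

definition normal_covering :: "('a, 'b) monoid_scheme \<Rightarrow> nat \<Rightarrow> (nat \<Rightarrow> 'a set) \<Rightarrow> bool" where
  "normal_covering G k H \<longleftrightarrow>
     (\<forall>i\<in>{1..k}. subgroup (H i) G \<and> H i \<noteq> carrier G) \<and>
     carrier G = (\<Union>i\<in>{1..k}. \<Union>g\<in>carrier G. conjugate_subgroup G (H i) g)"

text \<open>The value is \<open>\<infinity>\<close>, the infimum of the empty set, if there is no normal covering.\<close>

definition normal_covering_number :: "('a, 'b) monoid_scheme \<Rightarrow> enat" where
  "normal_covering_number G = Inf {enat k | k. \<exists>H. normal_covering G k H}"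

end

theory Submission
  imports Defs "HOL-Algebra.Group_Action" "HOL-Algebra.Sylow" "HOL-Algebra.SndIsomorphismGrp"
    "HOL-Number_Theory.Residues"
begin

text \<open>Maximal subgroups of a nilpotent group are normal, so two conjugacy classes of proper subgroups
  lie in a union of two proper subgroups, which is never the whole group.

  Conversely, let \<open>M\<close> be a non-normal maximal subgroup, let \<open>N \<subseteq> L\<close> be consecutive terms of the
  supersolvable series with \<open>N \<subseteq> M\<close> and \<open>\<not> L \<subseteq> M\<close>, and put \<open>A = L \<inter> M\<close>. All subgroups between \<open>N\<close>
  and \<open>L\<close> are normal, as \<open>L / N\<close> is cyclic. Let \<open>C\<close> be the centralizer of \<open>L / A\<close>, a proper subgroup
  because \<open>L\<close> does not normalize \<open>M\<close>. An element \<open>g = x m\<close> outside \<open>C\<close>, with \<open>x \<in> L\<close> and \<open>m \<in> M\<close>, acts on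
  \<open>L / A\<close> without fixed points, hence \<open>y \<mapsto> [y, m]\<close> is onto modulo \<open>A\<close> and \<open>g\<close> is conjugate into \<open>M\<close>.
  Thus \<open>C\<close> and \<open>M\<close> give a normal 2-covering. No single proper subgroup suffices, since the conjugates
  of \<open>M\<close> all meet \<open>L\<close> in the normal subgroup \<open>A\<close>.

  If all maximal subgroups are normal, so are all Sylow subgroups by the Frattini argument. They then
  centralize every section of prime order \<open>p\<close> of a cyclic normal section (by coprimality for the
  other primes, by Fermat's little theorem for \<open>p\<close> itself), so the upper central series reaches \<open>G\<close>.\<close>

section \<open>Cosets and commutation modulo a normal subgroup\<close>

lemma (in normal) r_coset_group_hom: "group_hom G (G Mod H) ((#>) H)"
  using factorgroup_is_group r_coset_hom_Mod by (simp add: group_hom_def group_hom_axioms_def is_group)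

lemma (in normal) r_coset_eq_self_iff:
  "x \<in> carrier G \<Longrightarrow> H #> x = H \<longleftrightarrow> x \<in> H"
  using coset_join1 coset_join2 subgroup_axioms by blast

lemma (in normal) r_coset_eq_iff:
  assumes "x \<in> carrier G" "y \<in> carrier G"
  shows "H #> x = H #> y \<longleftrightarrow> x \<otimes> inv y \<in> H"
proof -
  have "x \<otimes> inv y \<in> carrier G" using assms by simp
  then show ?thesis
    using coset_mult_inv1[OF _ assms subset] coset_mult_inv2[OF _ assms subset]
      r_coset_eq_self_iff by blast
qed

lemma (in group) r_coset_mono:
  assumes "subgroup N G" "subgroup A G" "N \<subseteq> A" "x \<in> carrier G" "y \<in> carrier G"
    and "N #> x = N #> y"
  shows "A #> x = A #> y"
proof -
  have "y \<in> N #> x"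
    using assms repr_independenceD by blast
  then have "y \<in> A #> x"
    using \<open>N \<subseteq> A\<close> by (auto simp: r_coset_def)
  then show ?thesis
    using assms repr_independence by blast
qed

lemma (in group) commute_inv:
  assumes "x \<otimes> y = y \<otimes> x" "x \<in> carrier G" "y \<in> carrier G"
  shows "inv x \<otimes> y = y \<otimes> inv x"
proof -
  have "inv x \<otimes> y = inv x \<otimes> (y \<otimes> x) \<otimes> inv x"
    using assms(2,3) by (simp add: m_assoc)
  also have "\<dots> = y \<otimes> inv x"
    using assms(2,3) by (simp add: assms(1)[symmetric] flip: m_assoc)
  finally show ?thesis .
qed

lemma (in group) conjugate_int_pow:
  fixes k :: int
  assumes g: "g \<in> carrier G" and x: "x \<in> carrier G"
  shows "g \<otimes> x [^] k \<otimes> inv g = (g \<otimes> x \<otimes> inv g) [^] k"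
proof -
  interpret c: group_hom G G "\<lambda>y. g \<otimes> y \<otimes> inv g"
    using g by (auto simp: group_hom_def group_hom_axioms_def is_group hom_def m_assoc inv_solve_left)
  show ?thesis by (rule c.hom_int_pow[OF x])
qed

text \<open>For normal \<open>A\<close>, this is the preimage in \<open>G\<close> of the centralizer
  of the image of \<open>S\<close> in \<open>G Mod A\<close>. It serves with \<open>S = L\<close>
  for the centralizer of a section, with a singleton for fixed points, and with
  \<open>S = carrier G\<close> for one step of the upper central series.\<close>

definition (in group) centralizer_modulo :: "'a set \<Rightarrow> 'a set \<Rightarrow> 'a set" where
  "centralizer_modulo A S = {g \<in> carrier G. \<forall>s\<in>S. A #> (g \<otimes> s) = A #> (s \<otimes> g)}"

lemma (in group) subgroup_centralizer_modulo:
  assumes "A \<lhd> G" "S \<subseteq> carrier G"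
  shows "subgroup (centralizer_modulo A S) G"
proof -
  interpret A: normal A G by fact
  interpret h: group_hom G "G Mod A" "(#>) A" by (rule A.r_coset_group_hom)
  \<comment> \<open>The coset equation is commutation in \<open>G Mod A\<close>, where
    \<open>commute_inv\<close> settles closure under inverses.\<close>
  have eq: "A #> (g \<otimes> s) = A #> (s \<otimes> g) \<longleftrightarrow>
      (A #> g) \<otimes>\<^bsub>G Mod A\<^esub> (A #> s) = (A #> s) \<otimes>\<^bsub>G Mod A\<^esub> (A #> g)"
    if "g \<in> carrier G" "s \<in> S" for g s
    using that assms(2) h.hom_mult[of g s] h.hom_mult[of s g] by (auto simp del: h.hom_mult mult_FactGroup)
  show ?thesis
  proof (rule subgroupI)
    show "centralizer_modulo A S \<subseteq> carrier G"
      by (auto simp: centralizer_modulo_def)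
    show "centralizer_modulo A S \<noteq> {}"
      using assms by (auto simp: centralizer_modulo_def intro!: exI[of _ \<one>])
  next
    fix a assume a: "a \<in> centralizer_modulo A S"
    then have "a \<in> carrier G" by (simp add: centralizer_modulo_def)
    have "A #> (inv a \<otimes> s) = A #> (s \<otimes> inv a)" if "s \<in> S" for s
    proof -
      have s: "s \<in> carrier G" using that assms by blast
      have "(A #> a) \<otimes>\<^bsub>G Mod A\<^esub> (A #> s) = (A #> s) \<otimes>\<^bsub>G Mod A\<^esub> (A #> a)"
        using a eq[OF \<open>a \<in> carrier G\<close> that] that by (simp add: centralizer_modulo_def)
      then have "inv\<^bsub>G Mod A\<^esub> (A #> a) \<otimes>\<^bsub>G Mod A\<^esub> (A #> s) = (A #> s) \<otimes>\<^bsub>G Mod A\<^esub> inv\<^bsub>G Mod A\<^esub> (A #> a)"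
        using h.H.commute_inv \<open>a \<in> carrier G\<close> s by (simp del: mult_FactGroup)
      then show ?thesis
        using eq[OF _ that, of "inv a"] \<open>a \<in> carrier G\<close> by simp
    qed
    then show "inv a \<in> centralizer_modulo A S"
      using \<open>a \<in> carrier G\<close> by (simp add: centralizer_modulo_def)
  next
    fix a b assume ab: "a \<in> centralizer_modulo A S" "b \<in> centralizer_modulo A S"
    then have car: "a \<in> carrier G" "b \<in> carrier G" by (auto simp: centralizer_modulo_def)
    have "A #> (a \<otimes> b \<otimes> s) = A #> (s \<otimes> (a \<otimes> b))" if "s \<in> S" for s
    proof -
      have s: "s \<in> carrier G" using that assms by blast
      have "A #> (a \<otimes> s) = A #> (s \<otimes> a)" "A #> (b \<otimes> s) = A #> (s \<otimes> b)"
        using ab that by (auto simp: centralizer_modulo_def)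
      then have "A #> (a \<otimes> (b \<otimes> s)) = A #> (a \<otimes> (s \<otimes> b))" "A #> (a \<otimes> s \<otimes> b) = A #> (s \<otimes> a \<otimes> b)"
        using car s A.rcos_sum by (metis m_closed)+
      then show ?thesis
        using car s by (simp add: m_assoc)
    qed
    then show "a \<otimes> b \<in> centralizer_modulo A S"
      using car by (simp add: centralizer_modulo_def)
  qed
qed

text \<open>Elements of \<open>H\<close> become trivial in \<open>G Mod H\<close>; concretely, the
  commutator of \<open>h\<close> and \<open>s\<close> lies in \<open>H\<close> by normality.\<close>

lemma (in normal) subset_centralizer_modulo:
  assumes "S \<subseteq> carrier G"
  shows "H \<subseteq> centralizer_modulo H S"
proof
  fix h assume h: "h \<in> H"
  have "H #> (h \<otimes> s) = H #> (s \<otimes> h)" if "s \<in> S" for s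
  proof -
    have s: "s \<in> carrier G" using that assms by blast
    have "h \<otimes> (s \<otimes> inv h \<otimes> inv s) \<in> H"
      using h s inv_op_closed2 by simp
    then show ?thesis
      using h s r_coset_eq_iff by (simp add: inv_mult_group m_assoc)
  qed
  then show "h \<in> centralizer_modulo H S"
    using h by (simp add: centralizer_modulo_def)
qed

section \<open>Cyclic sections between two normal subgroups\<close>

locale cyclic_section = group +
  fixes N L
  assumes normal_bottom: "N \<lhd> G" and normal_top: "L \<lhd> G" and bottom_subset_top: "N \<subseteq> L"
    and cyclic: "cyclic_group ((G\<lparr>carrier := L\<rparr>) Mod N)"
begin

sublocale N: normal N G by (rule normal_bottom)
sublocale L: normal L G by (rule normal_top)
sublocale quotient: group_hom G "G Mod N" "(#>) N" by (rule N.r_coset_group_hom)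

text \<open>Lifts a generator of \<open>L / N\<close> to an element of \<open>L\<close>, so that
  later computations take place in cosets of \<open>G\<close> rather than in the restricted
  group.\<close>

lemma generator:
  obtains t where "t \<in> L" "\<And>x. x \<in> L \<Longrightarrow> \<exists>k::int. N #> x = N #> (t [^] k)"
proof -
  have nN: "N \<lhd> (G\<lparr>carrier := L\<rparr>)"
    using normal_restrict_supergroup L.subgroup_axioms normal_bottom bottom_subset_top by blast
  interpret LN: normal N "G\<lparr>carrier := L\<rparr>" by (rule nN)
  interpret Q: group "(G\<lparr>carrier := L\<rparr>) Mod N" by (rule LN.factorgroup_is_group)
  obtain X where X: "X \<in> carrier ((G\<lparr>carrier := L\<rparr>) Mod N)"
     "carrier ((G\<lparr>carrier := L\<rparr>) Mod N) = range (\<lambda>n::int. X [^]\<^bsub>(G\<lparr>carrier := L\<rparr>) Mod N\<^esub> n)"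
    using cyclic Q.cyclic_group by blast
  from X(1) obtain t where t: "t \<in> L" "X = N #> t"
    by (auto simp: carrier_FactGroup)
  have "\<exists>k::int. N #> x = N #> (t [^] k)" if x: "x \<in> L" for x
  proof -
    have "N #> x \<in> carrier ((G\<lparr>carrier := L\<rparr>) Mod N)"
      using x by (auto simp: carrier_FactGroup)
    then obtain k :: int where "N #> x = X [^]\<^bsub>(G\<lparr>carrier := L\<rparr>) Mod N\<^esub> k"
      using X by auto
    then have "N #> x = N #> (t [^] k)"
      using LN.FactGroup_int_pow[of t k] t int_pow_consistent[OF L.subgroup_axioms t(1)] by simp
    then show ?thesis by blast
  qed
  then show ?thesis using that t by blast
qed

lemma commute:
  assumes "x \<in> L" "y \<in> L"
  shows "N #> (x \<otimes> y) = N #> (y \<otimes> x)"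
proof -
  obtain t where t: "t \<in> L" and gen: "\<And>x. x \<in> L \<Longrightarrow> \<exists>k::int. N #> x = N #> (t [^] k)"
    using generator by blast
  obtain i j :: int where ij: "N #> x = N #> (t [^] i)" "N #> y = N #> (t [^] j)"
    using gen assms by meson
  have "t \<in> carrier G" using t by simp
  then have "t [^] i \<otimes> t [^] j = t [^] j \<otimes> t [^] i"
    by (metis int_pow_mult add.commute)
  moreover have "N #> (x \<otimes> y) = N #> (t [^] i \<otimes> t [^] j)" "N #> (y \<otimes> x) = N #> (t [^] j \<otimes> t [^] i)"
    using assms ij \<open>t \<in> carrier G\<close> by (simp_all flip: N.rcos_sum)
  ultimately show ?thesis by simp
qed

text \<open>Automorphisms of a cyclic group are power maps: the exponent \<open>j\<close> read off
  at a generator \<open>t\<close> serves for every power of \<open>t\<close>.\<close>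

lemma conj_eq_power:
  assumes g: "g \<in> carrier G"
  shows "\<exists>j::int. \<forall>x\<in>L. N #> (g \<otimes> x \<otimes> inv g) = N #> (x [^] j)"
proof -
  obtain t where t: "t \<in> L" and gen: "\<And>x. x \<in> L \<Longrightarrow> \<exists>k::int. N #> x = N #> (t [^] k)"
    using generator by blast
  have tc: "t \<in> carrier G" using t by simp
  obtain j :: int where j: "N #> (g \<otimes> t \<otimes> inv g) = N #> (t [^] j)"
    using gen[of "g \<otimes> t \<otimes> inv g"] L.inv_op_closed2[OF g t] by blast
  have "N #> (g \<otimes> x \<otimes> inv g) = N #> (x [^] j)" if x: "x \<in> L" for x
  proof -
    obtain k :: int where k: "N #> x = N #> (t [^] k)" using gen[OF x] by blast
    have xc: "x \<in> carrier G" using x by simp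
    have "N #> (g \<otimes> x \<otimes> inv g) = N #> (g \<otimes> t [^] k \<otimes> inv g)"
      using k g xc tc by (simp flip: N.rcos_sum)
    also have "\<dots> = N #> ((g \<otimes> t \<otimes> inv g) [^] k)"
      using conjugate_int_pow[OF g tc] by simp
    also have "\<dots> = (N #> (t [^] j)) [^]\<^bsub>G Mod N\<^esub> k"
      using g tc j quotient.hom_int_pow[of "g \<otimes> t \<otimes> inv g" k] by simp
    also have "\<dots> = (N #> t) [^]\<^bsub>G Mod N\<^esub> (k * j)"
      using tc by (simp add: quotient.hom_int_pow quotient.H.int_pow_pow mult.commute)
    also have "\<dots> = (N #> x) [^]\<^bsub>G Mod N\<^esub> j"
      using tc k by (simp add: quotient.hom_int_pow quotient.H.int_pow_pow)
    also have "\<dots> = N #> (x [^] j)"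
      using xc by (simp add: quotient.hom_int_pow)
    finally show ?thesis .
  qed
  then show ?thesis by blast
qed

text \<open>Modulo \<open>N\<close>, conjugation raises elements of \<open>L\<close> to powers, and
  \<open>D\<close> is closed under powers and contains \<open>N\<close>.\<close>

lemma intermediate_normal:
  assumes D: "subgroup D G" and "N \<subseteq> D" "D \<subseteq> L"
  shows "D \<lhd> G"
proof (rule normal_invI[OF D])
  fix g d assume g: "g \<in> carrier G" and d: "d \<in> D"
  obtain j :: int where "N #> (g \<otimes> d \<otimes> inv g) = N #> (d [^] j)"
    using conj_eq_power[OF g] d \<open>D \<subseteq> L\<close> by blast
  then have "g \<otimes> d \<otimes> inv g \<in> N #> (d [^] j)"
    using g d D subgroup.mem_carrier[OF D] rcos_self N.subgroup_axioms by (metis inv_closed m_closed)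
  then obtain n where n: "n \<in> N" "g \<otimes> d \<otimes> inv g = n \<otimes> d [^] j"
    by (auto simp: r_coset_def)
  then show "g \<otimes> d \<otimes> inv g \<in> D"
    using D d \<open>N \<subseteq> D\<close> subgroup_int_pow_closed subgroup.m_closed by (metis subsetD)
qed

end

text \<open>Applied both to the supersolvable series and to the central series of a nilpotent
  group.\<close>

lemma exists_first_step_outside:
  fixes N :: "nat \<Rightarrow> 'b set"
  assumes "N 0 \<subseteq> M" "\<not> N n \<subseteq> M"
  obtains i where "i < n" "N i \<subseteq> M" "\<not> N (Suc i) \<subseteq> M"
  using assms by (induction n) (auto simp: less_Suc_eq)

text \<open>The series starts inside \<open>M\<close> and ends outside, so some step leaves
  \<open>M\<close>. Every use of supersolvability goes through this one section.\<close>

lemma (in group) supersolvable_section: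
  assumes "supersolvable_group G" "subgroup M G" "M \<noteq> carrier G"
  obtains N L where "cyclic_section G N L" "N \<subseteq> M" "\<not> L \<subseteq> M"
proof -
  obtain n N where N: "N 0 = {\<one>}" "N n = carrier G" "\<forall>i\<le>n. N i \<lhd> G"
    "\<forall>i<n. N i \<subseteq> N (Suc i) \<and> cyclic_group ((G\<lparr>carrier := N (Suc i)\<rparr>) Mod N i)"
    using assms(1) by (auto simp: supersolvable_group_def)
  have "N 0 \<subseteq> M" "\<not> N n \<subseteq> M"
    using N(1,2) assms subgroup.one_closed subgroup.subset by fastforce+
  then obtain i where i: "i < n" "N i \<subseteq> M" "\<not> N (Suc i) \<subseteq> M"
    by (rule exists_first_step_outside)
  have "cyclic_section G (N i) (N (Suc i))"
    using N i(1) by (simp add: cyclic_section_def cyclic_section_axioms_def is_group)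
  then show ?thesis using i that by blast
qed

section \<open>Conjugation, normalizers and maximal subgroups\<close>

lemma (in group) inv_cancel_left [simp]:
  "\<lbrakk>x \<in> carrier G; y \<in> carrier G\<rbrakk> \<Longrightarrow> inv x \<otimes> (x \<otimes> y) = y"
  "\<lbrakk>x \<in> carrier G; y \<in> carrier G\<rbrakk> \<Longrightarrow> x \<otimes> (inv x \<otimes> y) = y"
  by (simp_all flip: m_assoc)

lemma (in normal) r_coset_mult_cong:
  assumes "H #> u = H #> v" "a \<in> carrier G" "u \<in> carrier G" "v \<in> carrier G" "b \<in> carrier G"
  shows "H #> (a \<otimes> u \<otimes> b) = H #> (a \<otimes> v \<otimes> b)"
  using assms by (simp flip: rcos_sum)

text \<open>\<open>x m x^-1\<close> is the commutator \<open>x m x^-1 m^-1\<close>, which lies in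
  \<open>H\<close>, times \<open>m\<close>. Hence an element that centralizes \<open>M\<close>
  modulo \<open>H\<close> conjugates \<open>M\<close> into itself.\<close>

lemma (in normal) conjugate_mem_if_commute_modulo:
  assumes M: "subgroup M G" "H \<subseteq> M" and x: "x \<in> carrier G" and m: "m \<in> M"
    and comm: "H #> (x \<otimes> m) = H #> (m \<otimes> x)"
  shows "x \<otimes> m \<otimes> inv x \<in> M"
proof -
  interpret M: subgroup M G by fact
  have "x \<otimes> m \<otimes> inv (m \<otimes> x) \<in> H"
    using comm m x r_coset_eq_iff by simp
  then have "x \<otimes> m \<otimes> inv (m \<otimes> x) \<otimes> m \<in> M"
    using m M(2) by blast
  then show ?thesis
    using m x by (simp add: inv_mult_group m_assoc)
qed

text \<open>\<open>normalizer\<close> demands that the conjugate equal \<open>H\<close>; for finite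
  \<open>H\<close> inclusion is enough, because conjugation is injective.\<close>

lemma (in group) mem_normalizerI:
  assumes "H \<subseteq> carrier G" "finite H" "g \<in> carrier G" "\<And>h. h \<in> H \<Longrightarrow> g \<otimes> h \<otimes> inv g \<in> H"
  shows "g \<in> normalizer G H"
proof -
  have "inj_on (\<lambda>h. g \<otimes> h \<otimes> inv g) H"
    using assms conjugation_is_inj by (meson inj_onI subsetD)
  then have "(\<lambda>h. g \<otimes> h \<otimes> inv g) ` H = H"
    using assms by (intro endo_inj_surj) auto
  moreover have "g <# H #> inv g = (\<lambda>h. g \<otimes> h \<otimes> inv g) ` H"
    by (auto simp: l_coset_def r_coset_def)
  ultimately show ?thesis
    using assms by (simp add: normalizer_def stabilizer_def)
qed

lemma (in group) mem_normalizerD: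
  assumes "g \<in> normalizer G H" "H \<subseteq> carrier G" "h \<in> H"
  shows "g \<otimes> h \<otimes> inv g \<in> H"
proof -
  have "g <# H #> inv g = H"
    using assms by (simp add: normalizer_def stabilizer_def)
  then show ?thesis
    using assms(3) by (auto simp: l_coset_def r_coset_def)
qed

lemma (in group) subgroup_subset_normalizer:
  assumes "subgroup H G" "finite H"
  shows "H \<subseteq> normalizer G H"
proof
  interpret H: subgroup H G by fact
  fix h assume "h \<in> H"
  then show "h \<in> normalizer G H"
    using mem_normalizerI[OF H.subset assms(2)] by simp
qed

lemma (in group) normal_iff_normalizer:
  assumes "subgroup H G" "finite H"
  shows "H \<lhd> G \<longleftrightarrow> normalizer G H = carrier G"
proof
  assume "H \<lhd> G"
  then interpret H: normal H G .
  have "carrier G \<subseteq> normalizer G H"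
    using mem_normalizerI[OF H.subset assms(2)] H.inv_op_closed2 by (simp add: subset_iff)
  then show "normalizer G H = carrier G"
    using subgroup.subset[OF normalizer_imp_subgroup[OF subgroup.subset[OF assms(1)]]] by blast
next
  assume "normalizer G H = carrier G"
  then show "H \<lhd> G"
    using mem_normalizerD[OF _ subgroup.subset[OF assms(1)]] normal_invI[OF assms(1)] by simp
qed

definition maximal_subgroup :: "'a set \<Rightarrow> ('a, 'b) monoid_scheme \<Rightarrow> bool" where
  "maximal_subgroup M G \<longleftrightarrow> subgroup M G \<and> M \<noteq> carrier G \<and>
     (\<forall>K. subgroup K G \<longrightarrow> M \<subseteq> K \<longrightarrow> K = M \<or> K = carrier G)"

lemma (in group) exists_maximal_subgroup:
  assumes "finite (carrier G)" "subgroup H G" "H \<noteq> carrier G"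
  obtains M where "maximal_subgroup M G" "H \<subseteq> M"
proof -
  let ?S = "{K. subgroup K G \<and> K \<noteq> carrier G}"
  have "?S \<subseteq> Pow (carrier G)"
    using subgroup.subset by blast
  then have "finite ?S"
    by (rule finite_subset) (simp add: assms(1))
  then have "\<exists>M\<in>?S. H \<subseteq> M \<and> (\<forall>K\<in>?S. M \<subseteq> K \<longrightarrow> M = K)"
    by (rule finite_has_maximal2) (simp add: assms)
  then show ?thesis
    using that unfolding maximal_subgroup_def by (metis (mono_tags, lifting) mem_Collect_eq)
qed

text \<open>The normalizer is a subgroup above \<open>M\<close>; once it is larger than
  \<open>M\<close>, maximality makes it all of \<open>G\<close>.\<close>

lemma (in group) maximal_subgroup_normal:
  assumes "finite (carrier G)" "maximal_subgroup M G" "\<not> normalizer G M \<subseteq> M"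
  shows "M \<lhd> G"
proof -
  have M: "subgroup M G" "finite M"
    using assms finite_subset subgroup.subset by (auto simp: maximal_subgroup_def)
  have "subgroup (normalizer G M) G" "M \<subseteq> normalizer G M"
    using M subgroup_subset_normalizer normalizer_imp_subgroup subgroup.subset by blast+
  then have "normalizer G M = carrier G"
    using assms(2,3) by (auto simp: maximal_subgroup_def)
  then show ?thesis using M normal_iff_normalizer by blast
qed

text \<open>As \<open>L\<close> is normal, \<open>L <#> M\<close> is a subgroup. It contains
  \<open>M\<close> and also \<open>L\<close>, so it is strictly larger than
  \<open>M\<close>.\<close>

lemma (in group) maximal_subgroup_normal_mult:
  assumes "maximal_subgroup M G" "L \<lhd> G" "\<not> L \<subseteq> M"
  shows "L <#> M = carrier G"
proof -
  have M: "subgroup M G"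
    using assms by (simp add: maximal_subgroup_def)
  interpret L: normal L G by fact
  interpret second_isomorphism_grp L G M
    by (simp add: second_isomorphism_grp_def second_isomorphism_grp_axioms_def M L.normal_axioms)
  have "M \<subseteq> L <#> M" "L \<subseteq> L <#> M"
    using S_contained_in_set_mult H_contained_in_set_mult by auto
  then show ?thesis
    using assms normal_set_mult_subgroup by (metis maximal_subgroup_def)
qed

section \<open>Covering by conjugates of proper subgroups\<close>

lemma (in group) mem_conjugate_subgroup:
  assumes "H \<subseteq> carrier G" "g \<in> carrier G"
  shows "x \<in> conjugate_subgroup G H g \<longleftrightarrow> x \<in> carrier G \<and> g \<otimes> x \<otimes> inv g \<in> H"
proof
  assume "x \<in> conjugate_subgroup G H g"
  then obtain h where "h \<in> H" "x = inv g \<otimes> h \<otimes> g"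
    by (auto simp: conjugate_subgroup_def l_coset_def r_coset_def)
  then show "x \<in> carrier G \<and> g \<otimes> x \<otimes> inv g \<in> H"
    using assms by (auto simp: m_assoc subset_iff)
next
  assume x: "x \<in> carrier G \<and> g \<otimes> x \<otimes> inv g \<in> H"
  then have "x = inv g \<otimes> (g \<otimes> x \<otimes> inv g) \<otimes> g"
    using assms by (simp add: m_assoc)
  then show "x \<in> conjugate_subgroup G H g"
    using x unfolding conjugate_subgroup_def l_coset_def r_coset_def by blast
qed

lemma (in cyclic_section) intersection:
  assumes "subgroup M G" "N \<subseteq> M"
  shows "L \<inter> M \<lhd> G"
  using assms bottom_subset_top L.subgroup_axioms subgroups_Inter_pair intermediate_normal by simp

text \<open>Jordan's theorem for supersolvable groups: conjugates of an element of \<open>L\<close>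
  stay in \<open>L\<close>, so one in \<open>H\<close> would lie in the normal subgroup
  \<open>L \<inter> H\<close>, and the element itself would too.\<close>

lemma (in group) supersolvable_not_covered_by_conjugates:
  assumes "supersolvable_group G" "subgroup H G" "H \<noteq> carrier G"
  shows "\<exists>x\<in>carrier G. \<forall>g\<in>carrier G. x \<notin> conjugate_subgroup G H g"
proof -
  obtain N L where NL: "cyclic_section G N L" "N \<subseteq> H" "\<not> L \<subseteq> H"
    using assms supersolvable_section by blast
  interpret cyclic_section G N L by fact
  interpret A: normal "L \<inter> H" G
    using intersection assms NL by blast
  obtain x where x: "x \<in> L" "x \<notin> H" using NL by blast
  have "x \<notin> conjugate_subgroup G H g" if g: "g \<in> carrier G" for g
  proof
    assume "x \<in> conjugate_subgroup G H g"
    then have "g \<otimes> x \<otimes> inv g \<in> L \<inter> H"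
      using mem_conjugate_subgroup[OF subgroup.subset[OF assms(2)] g] L.inv_op_closed2[OF g x(1)]
      by simp
    then have "inv g \<otimes> (g \<otimes> x \<otimes> inv g) \<otimes> g \<in> L \<inter> H"
      using g A.inv_op_closed1 by blast
    then show False
      using x g by (simp add: m_assoc)
  qed
  then show ?thesis using L.mem_carrier[OF x(1)] by (intro bexI[of _ x]) simp_all
qed

text \<open>The witness is the centralizer of \<open>L / A\<close> with
  \<open>A = L \<inter> M\<close>. Elements outside it are conjugated into \<open>M\<close> by a
  counting argument on the cosets of \<open>A\<close> in \<open>L\<close>.\<close>

lemma (in group) nonnormal_maximal_subgroup_covers:
  assumes fin: "finite (carrier G)" and sups: "supersolvable_group G"
    and max: "maximal_subgroup M G" and nonnormal: "\<not> M \<lhd> G"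
  shows "\<exists>C. subgroup C G \<and> C \<noteq> carrier G \<and>
    (\<forall>g\<in>carrier G. g \<in> C \<or> (\<exists>y\<in>carrier G. y \<otimes> g \<otimes> inv y \<in> M))"
proof -
  have M: "subgroup M G" "M \<noteq> carrier G"
    using max by (auto simp: maximal_subgroup_def)
  interpret M: subgroup M G by fact
  obtain N L where NL: "cyclic_section G N L" "N \<subseteq> M" "\<not> L \<subseteq> M"
    using M sups supersolvable_section by blast
  interpret cyclic_section G N L by fact
  define A where "A = L \<inter> M"
  interpret A: normal A G
    using intersection M NL unfolding A_def by blast
  have NA: "N \<subseteq> A" using bottom_subset_top NL by (auto simp: A_def)
  define C where "C = centralizer_modulo A L"
  have C: "subgroup C G"
    unfolding C_def by (rule subgroup_centralizer_modulo[OF A.normal_axioms L.subset])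
  obtain x0 where x0: "x0 \<in> L" "x0 \<notin> M" using NL by blast
  \<comment> \<open>Otherwise \<open>x0\<close>, which lies outside \<open>M\<close>, would
    normalize \<open>M\<close>, and the maximal subgroup \<open>M\<close> would be normal.\<close>
  have "C \<noteq> carrier G"
  proof
    assume "C = carrier G"
    have "x0 \<otimes> m \<otimes> inv x0 \<in> M" if m: "m \<in> M" for m
    proof -
      have "m \<in> C" using m \<open>C = carrier G\<close> by simp
      then have "A #> (x0 \<otimes> m) = A #> (m \<otimes> x0)"
        using x0 by (simp add: C_def centralizer_modulo_def)
      then show ?thesis
        using A.conjugate_mem_if_commute_modulo[OF M(1)] x0 m by (simp add: A_def)
    qed
    then have "x0 \<in> normalizer G M"
      using mem_normalizerI x0 fin by (meson L.mem_carrier M.subset finite_subset)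
    then show False
      using maximal_subgroup_normal[OF fin max] x0 nonnormal by blast
  qed
  moreover have "\<exists>y\<in>carrier G. y \<otimes> g \<otimes> inv y \<in> M" if g: "g \<in> carrier G" "g \<notin> C" for g
  proof -
    obtain x m where xm: "x \<in> L" "m \<in> M" "g = x \<otimes> m"
      using g maximal_subgroup_normal_mult[OF max normal_top NL(3)] unfolding set_mult_def by blast
    \<comment> \<open>\<open>L\<close> is commutative modulo \<open>N\<close>, hence modulo
      \<open>A\<close>. With \<open>x\<close> in \<open>C\<close>, the failure of \<open>g\<close>
      to lie in \<open>C\<close> is due to \<open>m\<close>.\<close>
    have "x \<in> C"
      using xm commute r_coset_mono[OF N.subgroup_axioms A.subgroup_axioms NA]
      by (simp add: C_def centralizer_modulo_def)
    then have "m \<notin> C"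
      using g(2) xm(3) subgroup.m_closed[OF C \<open>x \<in> C\<close>] by auto
    \<comment> \<open>\<open>D / A\<close> consists of the fixed points of \<open>m\<close> on
      \<open>L / A\<close>; the claim \<open>D = A\<close> says that there are only trivial
      ones.\<close>
    define D where "D = L \<inter> centralizer_modulo A {m}"
    have "subgroup D G"
      using xm A.normal_axioms unfolding D_def
      by (intro subgroups_Inter_pair subgroup_centralizer_modulo L.subgroup_axioms) auto
    moreover have "A \<subseteq> D"
      using A.subset_centralizer_modulo[of "{m}"] xm by (auto simp: D_def A_def)
    ultimately have "D \<lhd> G"
      using intermediate_normal NA by (auto simp: D_def)
    have "D = A"
    proof (rule ccontr)
      assume "D \<noteq> A"
      then have "\<not> D \<subseteq> M"
        using \<open>A \<subseteq> D\<close> by (auto simp: A_def D_def)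
      then have "D <#> M = carrier G"
        using maximal_subgroup_normal_mult[OF max \<open>D \<lhd> G\<close>] by blast
      \<comment> \<open>Dedekind's law: from \<open>D <#> M = carrier G\<close> and
        \<open>D \<subseteq> L\<close> follows \<open>L = D (L \<inter> M) = D A = D\<close>, so
        \<open>m\<close> would centralize all of \<open>L / A\<close>.\<close>
      have "L \<subseteq> D"
      proof
        fix l assume l: "l \<in> L"
        then obtain d k where dk: "d \<in> D" "k \<in> M" "l = d \<otimes> k"
          using \<open>D <#> M = carrier G\<close> L.mem_carrier[OF l] unfolding set_mult_def by blast
        have "d \<in> L" using dk by (simp add: D_def)
        have "inv d \<otimes> l \<in> L" using \<open>d \<in> L\<close> l by simp
        moreover have "inv d \<otimes> l = k" unfolding dk(3) using \<open>d \<in> L\<close> dk(2) by simp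
        ultimately have "k \<in> D"
          using dk(2) \<open>A \<subseteq> D\<close> by (auto simp: A_def)
        then show "l \<in> D" using dk(1,3) subgroup.m_closed[OF \<open>subgroup D G\<close>] by simp
      qed
      then have "m \<in> C"
        using xm by (auto simp: D_def C_def centralizer_modulo_def)
      then show False using \<open>m \<notin> C\<close> by blast
    qed
    \<comment> \<open>\<open>e\<close> is the coset map and \<open>h\<close> the commutator of
      \<open>inv y\<close> and \<open>m\<close> modulo \<open>A\<close>. If
      \<open>h y = h y'\<close>, then \<open>y' y^-1\<close> commutes with \<open>m\<close> modulo
      \<open>A\<close>, so it lies in \<open>D = A\<close>.\<close>
    define e where "e y = A #> y" for y
    define h where "h y = A #> (inv y \<otimes> m \<otimes> y \<otimes> inv m)" for y
    have mc: "m \<in> carrier G" using xm by simp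
    have "e y = e y'" if yy: "y \<in> L" "y' \<in> L" "h y = h y'" for y y'
    proof -
      have c: "y \<in> carrier G" "y' \<in> carrier G" using yy by auto
      have "A #> (y' \<otimes> (inv y \<otimes> m \<otimes> y \<otimes> inv m) \<otimes> (m \<otimes> inv y)) =
          A #> (y' \<otimes> (inv y' \<otimes> m \<otimes> y' \<otimes> inv m) \<otimes> (m \<otimes> inv y))"
        using c mc yy(3) by (intro A.r_coset_mult_cong) (auto simp: h_def)
      then have "A #> (y' \<otimes> inv y \<otimes> m) = A #> (m \<otimes> (y' \<otimes> inv y))"
        using c mc by (simp add: m_assoc)
      then have "y' \<otimes> inv y \<in> A"
        using yy \<open>D = A\<close> by (auto simp: D_def centralizer_modulo_def)
      then show ?thesis
        using c A.r_coset_eq_iff[of y' y] by (simp add: e_def)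
    qed
    have finL: "finite L" using fin L.subset finite_subset by blast
    \<comment> \<open>On \<open>L\<close> the map \<open>e\<close> factors through \<open>h\<close>,
      with \<open>SOME\<close> picking a preimage. So \<open>h\<close> takes at least as many values
      as \<open>e\<close>; its values being cosets of elements of \<open>L\<close>, it takes them
      all.\<close>
    have "e ` L = (\<lambda>X. e (SOME y. y \<in> L \<and> h y = X)) ` (h ` L)"
    proof -
      have "e y = e (SOME z. z \<in> L \<and> h z = h y)" if "y \<in> L" for y
        using \<open>\<And>y y'. y \<in> L \<Longrightarrow> y' \<in> L \<Longrightarrow> h y = h y' \<Longrightarrow> e y = e y'\<close> that
          someI[of "\<lambda>z. z \<in> L \<and> h z = h y" y] by metis
      then show ?thesis by (simp add: image_image)
    qed
    then have "card (e ` L) \<le> card (h ` L)"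
      using finL card_image_le by (metis finite_imageI)
    moreover have "h ` L \<subseteq> e ` L"
    proof
      fix X assume "X \<in> h ` L"
      then obtain y where y: "y \<in> L" "X = h y" by blast
      have "inv y \<otimes> (m \<otimes> y \<otimes> inv m) \<in> L"
        using y mc L.inv_op_closed2 by simp
      then show "X \<in> e ` L"
        using y mc by (auto simp: h_def e_def m_assoc)
    qed
    ultimately have "h ` L = e ` L"
      using finL card_seteq by (metis finite_imageI)
    then have "e x \<in> h ` L" using xm(1) by blast
    then obtain y where y: "y \<in> L" "A #> x = A #> (inv y \<otimes> m \<otimes> y \<otimes> inv m)"
      unfolding e_def h_def by blast
    have c: "x \<in> carrier G" "y \<in> carrier G" using xm y by auto
    \<comment> \<open>Replacing \<open>x\<close> by \<open>y^-1 m y m^-1\<close> turns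
      \<open>y x m y^-1\<close>, the conjugate of \<open>g\<close>, into \<open>m\<close> modulo
      \<open>A\<close>; and \<open>A\<close> lies in \<open>M\<close>.\<close>
    have "A #> (y \<otimes> x \<otimes> (m \<otimes> inv y)) = A #> (y \<otimes> (inv y \<otimes> m \<otimes> y \<otimes> inv m) \<otimes> (m \<otimes> inv y))"
      using c mc y(2) by (intro A.r_coset_mult_cong) auto
    then have "A #> (y \<otimes> g \<otimes> inv y) = A #> m"
      using c mc by (simp add: m_assoc xm(3))
    then have "y \<otimes> g \<otimes> inv y \<otimes> inv m \<in> A"
      using A.r_coset_eq_iff c g mc by simp
    then have "y \<otimes> g \<otimes> inv y \<otimes> inv m \<otimes> m \<in> M"
      using xm(2) by (auto simp: A_def)
    then have "y \<otimes> g \<otimes> inv y \<in> M"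
      using c g mc by (simp add: m_assoc)
    then show ?thesis using c by blast
  qed
  ultimately show ?thesis using C by (intro exI[of _ C]) blast
qed

section \<open>Sylow conjugacy and the Frattini argument\<close>

text \<open>Orbit sizes are powers of \<open>p\<close> and sum to \<open>card E\<close>, so some
  orbit has size prime to \<open>p\<close>, that is, size 1.\<close>

lemma (in group_action) p_group_has_fixed_point:
  assumes "prime p" "order G = p ^ a" "finite E" "\<not> p dvd card E"
  shows "\<exists>x\<in>E. \<forall>g\<in>carrier G. \<phi> g x = x"
proof -
  have "\<exists>orb\<in>orbits G E \<phi>. \<not> p dvd card orb"
  proof (rule ccontr)
    assume "\<not> ?thesis"
    then have "p dvd (\<Sum>orb\<in>orbits G E \<phi>. card orb)"
      by (auto intro: dvd_sum)
    also have "(\<Sum>orb\<in>orbits G E \<phi>. card orb) = card E"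
      using disjoint_sum[OF \<open>finite E\<close>, of "\<lambda>_. 1 :: nat"] by simp
    finally show False using assms by blast
  qed
  then obtain x where x: "x \<in> E" "\<not> p dvd card (orbit G \<phi> x)"
    by (auto simp: orbits_def)
  have "card (orbit G \<phi> x) dvd p ^ a"
    using orbit_stabilizer_theorem[OF x(1)] assms(2) by (metis dvd_triv_left)
  then obtain i where i: "card (orbit G \<phi> x) = p ^ i"
    using divides_primepow_nat[OF \<open>prime p\<close>] by blast
  then have "card (orbit G \<phi> x) = 1"
    using x(2) by (cases i) auto
  moreover have "x \<in> orbit G \<phi> x"
    using orbit_refl x(1) by blast
  ultimately have "orbit G \<phi> x = {x}"
    by (auto simp: card_1_singleton_iff)
  then have "\<forall>g\<in>carrier G. \<phi> g x = x"
    by (auto simp: orbit_def)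
  then show ?thesis using x(1) by blast
qed

lemma (in group) card_subgroup_dvd:
  assumes "subgroup P G" "subgroup M G" "P \<subseteq> M"
  shows "card P dvd card M"
proof -
  interpret M: group "G\<lparr>carrier := M\<rparr>" using assms(2) subgroup_imp_group by blast
  have "subgroup P (G\<lparr>carrier := M\<rparr>)"
    using assms subgroup_incl by blast
  then have "card (rcosets\<^bsub>G\<lparr>carrier := M\<rparr>\<^esub> P) * card P = card M"
    using M.lagrange by (simp add: order_def)
  then show ?thesis by (metis dvd_triv_right)
qed

text \<open>Sylow conjugacy inside a subgroup \<open>M\<close>: the \<open>p\<close>-group \<open>Q\<close> acts on the right cosets of
  \<open>P\<close> in \<open>M\<close>, whose number is prime to \<open>p\<close>, and a fixed coset \<open>P #> m\<close> gives \<open>m Q m\<inverse> \<subseteq> P\<close>.\<close>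

lemma (in group) sylow_conjugate:
  assumes fin: "finite (carrier G)" and p: "prime p" and M: "subgroup M G"
    and P: "subgroup P G" "P \<subseteq> M" and Q: "subgroup Q G" "Q \<subseteq> M"
    and cQ: "card Q = p ^ a" and cM: "card M = card P * k" "\<not> p dvd k"
  shows "\<exists>m\<in>M. \<forall>q\<in>Q. m \<otimes> q \<otimes> inv m \<in> P"
proof -
  interpret M: subgroup M G by fact
  interpret P: subgroup P G by fact
  interpret Q: subgroup Q G by fact
  interpret GM: group "G\<lparr>carrier := M\<rparr>" using M subgroup_imp_group by blast
  define E where "E = (\<lambda>m. P #> m) ` M"
  \<comment> \<open>Right multiplication by \<open>inv q\<close> makes a left action; the
    restriction to \<open>E\<close> gives the extensionality that \<open>Bij E\<close>
    requires.\<close>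
  define \<phi> where "\<phi> = (\<lambda>q. \<lambda>X\<in>E. X #> inv q)"
  have finE: "finite E"
    unfolding E_def using fin M.subset finite_subset by blast
  have sub: "X \<subseteq> carrier G" if "X \<in> E" for X
    using that r_coset_subset_G[OF P.subset M.mem_carrier] by (auto simp: E_def)
  have closed: "X #> q \<in> E" if XE: "X \<in> E" and q: "q \<in> Q" for X q
  proof -
    obtain m where m: "m \<in> M" "X = P #> m" using XE by (auto simp: E_def)
    have "X #> q = P #> (m \<otimes> q)"
      using m q P.subset by (simp add: coset_mult_assoc)
    moreover have "m \<otimes> q \<in> M" using m q Q(2) by blast
    ultimately show ?thesis by (simp add: E_def)
  qed
  have bij: "\<phi> q \<in> Bij E" if q: "q \<in> Q" for q
  proof -
    have "bij_betw (\<phi> q) E E"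
    proof (rule bij_betw_byWitness[where f' = "\<lambda>X. X #> q"])
      show "\<forall>X\<in>E. \<phi> q X #> q = X" "\<forall>X\<in>E. \<phi> q (X #> q) = X"
        using q sub closed by (simp_all add: \<phi>_def coset_mult_assoc)
      show "\<phi> q ` E \<subseteq> E" "(\<lambda>X. X #> q) ` E \<subseteq> E"
        using q closed by (auto simp: \<phi>_def)
    qed
    then show ?thesis by (simp add: Bij_def \<phi>_def)
  qed
  have "\<phi> \<in> hom (G\<lparr>carrier := Q\<rparr>) (BijGroup E)"
  proof (rule homI)
    fix q r assume "q \<in> carrier (G\<lparr>carrier := Q\<rparr>)" "r \<in> carrier (G\<lparr>carrier := Q\<rparr>)"
    then have qr: "q \<in> Q" "r \<in> Q" by simp_all
    have "\<phi> (q \<otimes> r) = compose E (\<phi> q) (\<phi> r)"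
      using qr sub closed by (auto simp: \<phi>_def compose_def fun_eq_iff coset_mult_assoc inv_mult_group)
    then show "\<phi> (q \<otimes>\<^bsub>G\<lparr>carrier := Q\<rparr>\<^esub> r) = \<phi> q \<otimes>\<^bsub>BijGroup E\<^esub> \<phi> r"
      using bij qr by (simp add: BijGroup_def)
  qed (use bij in \<open>simp add: BijGroup_def\<close>)
  then interpret act: group_action "G\<lparr>carrier := Q\<rparr>" E \<phi>
    using Q(1) subgroup_imp_group group_BijGroup
    by (simp add: group_action_def group_hom_def group_hom_axioms_def)
  have "E = rcosets\<^bsub>G\<lparr>carrier := M\<rparr>\<^esub> P"
    by (auto simp: E_def RCOSETS_def)
  moreover have "subgroup P (G\<lparr>carrier := M\<rparr>)"
    using P M subgroup_incl by blast
  ultimately have "card E * card P = card P * k"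
    using GM.lagrange cM(1) by (simp add: order_def)
  moreover have "card P \<noteq> 0"
    by (metis P.one_closed P.subset card_eq_0_iff empty_iff fin finite_subset)
  ultimately have "\<not> p dvd card E"
    using cM(2) by simp
  then obtain X where X: "X \<in> E" "\<forall>q\<in>Q. \<phi> q X = X"
    using act.p_group_has_fixed_point[OF p _ finE, of a] cQ by (auto simp: order_def)
  then obtain m where m: "m \<in> M" "X = P #> m" by (auto simp: E_def)
  have "m \<otimes> q \<otimes> inv m \<in> P" if q: "q \<in> Q" for q
  proof -
    have "\<phi> (inv q) X = X" using X(2) q by simp
    then have "P #> (m \<otimes> q) = P #> m"
      using X(1) m q P.subset by (simp add: \<phi>_def coset_mult_assoc)
    then have "m \<otimes> q \<in> P #> m"
      using m q rcos_self[OF _ P(1), of "m \<otimes> q"] by simp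
    then show ?thesis
      using P.rcos_module_imp[OF group_axioms] m by simp
  qed
  then show ?thesis using m by blast
qed

text \<open>For \<open>g\<close> in \<open>G\<close>, the conjugate \<open>g P g^-1\<close> is again
  a Sylow subgroup of \<open>M\<close>, so some \<open>m\<close> in \<open>M\<close> carries it back
  into \<open>P\<close>. Then \<open>m g\<close> normalizes \<open>P\<close>, hence lies in
  \<open>M\<close>, and so does \<open>g\<close>.\<close>

lemma (in group) frattini_argument:
  assumes fin: "finite (carrier G)" and p: "prime p"
    and P: "subgroup P G" "card P = p ^ multiplicity p (order G)"
    and M: "M \<lhd> G" "normalizer G P \<subseteq> M"
  shows "M = carrier G"
proof -
  interpret M: normal M G by fact
  interpret P: subgroup P G by fact
  have finP: "finite P" using fin P.subset finite_subset by blast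
  have PM: "P \<subseteq> M"
    using subgroup_subset_normalizer[OF P(1) finP] M(2) by blast
  obtain k where k: "card M = card P * k"
    using card_subgroup_dvd[OF P(1) M.subgroup_axioms PM] by blast
  have "card M dvd order G"
    using lagrange[OF M.subgroup_axioms] by (metis dvd_triv_right)
  \<comment> \<open>\<open>P\<close> already has the full power of \<open>p\<close> in
    \<open>order G\<close>, and \<open>card M\<close> divides \<open>order G\<close>.\<close>
  have "\<not> p dvd k"
  proof
    assume "p dvd k"
    then have "p ^ Suc (multiplicity p (order G)) dvd card M"
      using k P(2) by (metis mult_dvd_mono dvd_refl power_Suc2)
    then have "p ^ Suc (multiplicity p (order G)) dvd order G"
      using \<open>card M dvd order G\<close> by (rule dvd_trans)
    moreover have "order G \<noteq> 0" using fin order_gt_0_iff_finite by simp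
    ultimately show False
      using prime_gt_1_nat[OF p] by (simp add: power_dvd_iff_le_multiplicity del: power_Suc)
  qed
  have "g \<in> M" if g: "g \<in> carrier G" for g
  proof -
    define Q where "Q = (\<lambda>x. g \<otimes> x \<otimes> inv g) ` P"
    have "Q = g <# P #> inv g"
      by (auto simp: Q_def l_coset_def r_coset_def)
    then have "subgroup Q G"
      using subgroup_conjugation_is_surj2[OF g P(1)] by simp
    moreover have "Q \<subseteq> M"
      using PM g M.inv_op_closed2 by (auto simp: Q_def)
    moreover have "inj_on (\<lambda>x. g \<otimes> x \<otimes> inv g) P"
      using conjugation_is_inj[OF g] by (meson P.mem_carrier inj_onI)
    then have "card Q = p ^ multiplicity p (order G)"
      using P(2) by (simp add: Q_def card_image)
    ultimately obtain m where m: "m \<in> M" "\<forall>q\<in>Q. m \<otimes> q \<otimes> inv m \<in> P"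
      using sylow_conjugate[OF fin p M.subgroup_axioms P(1) PM _ _ _ k \<open>\<not> p dvd k\<close>] by blast
    have "m \<otimes> g \<in> normalizer G P"
    proof (rule mem_normalizerI[OF P.subset finP])
      show "m \<otimes> g \<in> carrier G" using m g by simp
      fix x assume x: "x \<in> P"
      then have "m \<otimes> (g \<otimes> x \<otimes> inv g) \<otimes> inv m \<in> P"
        using m by (auto simp: Q_def)
      then show "m \<otimes> g \<otimes> x \<otimes> inv (m \<otimes> g) \<in> P"
        using m g x by (simp add: m_assoc inv_mult_group)
    qed
    then have "inv m \<otimes> (m \<otimes> g) \<in> M"
      using m M(2) by blast
    then show ?thesis using m g by simp
  qed
  then show ?thesis using M.subset by blast
qed

section \<open>Centralizing elements of prime order in a cyclic section\<close>

text \<open>If some \<open>y\<close> in \<open>L\<close> has order \<open>p k\<close> modulo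
  \<open>H\<close>, then \<open>y [^] k\<close> has order \<open>p\<close> there.\<close>

lemma (in normal) exists_prime_order_modulo:
  assumes "finite (carrier G)" "subgroup L G" "\<not> L \<subseteq> H"
  obtains p x where "prime (p :: nat)" "x \<in> L" "x \<notin> H" "x [^] p \<in> H"
proof -
  interpret Q: group_hom G "G Mod H" "(#>) H" by (rule r_coset_group_hom)
  obtain y where y: "y \<in> L" "y \<notin> H" using assms(3) by blast
  have yc: "y \<in> carrier G" using subgroup.mem_carrier[OF assms(2) y(1)] .
  define n where "n = Q.H.ord (H #> y)"
  have "finite (carrier (G Mod H))"
    using assms(1) by (simp add: carrier_FactGroup)
  then have "n \<noteq> 0"
    using Q.H.ord_ge_1[of "H #> y"] Q.hom_closed[OF yc] unfolding n_def by linarith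
  have "n \<noteq> 1"
    using Q.H.ord_eq_1[of "H #> y"] Q.hom_closed[OF yc] r_coset_eq_self_iff[OF yc] y(2)
    unfolding n_def by simp
  then obtain p where p: "prime p" "p dvd n"
    using prime_factor_nat by blast
  then obtain k where k: "n = p * k" by blast
  have eq: "y [^] i \<in> H \<longleftrightarrow> n dvd i" for i :: nat
    using Q.H.pow_eq_id[of "H #> y" i] Q.hom_closed[OF yc] r_coset_eq_self_iff[of "y [^] i"] yc
    unfolding n_def by (simp add: Q.hom_nat_pow)
  have "k \<noteq> 0" "k < n"
    using k \<open>n \<noteq> 0\<close> prime_gt_1_nat[OF p(1)] by auto
  then have "y [^] k \<notin> H"
    using eq by (auto dest: dvd_imp_le)
  moreover have "(y [^] k) [^] p \<in> H"
    using eq yc k by (simp add: nat_pow_pow mult.commute)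
  moreover have "y [^] k \<in> L"
    using subgroup_int_pow_closed[OF assms(2) y(1), of "int k"] unfolding int_pow_int .
  ultimately show ?thesis using that p(1) by blast
qed

lemma (in group) subgroup_pow_card:
  assumes "subgroup P G" "g \<in> P"
  shows "g [^] card P = \<one>"
proof -
  interpret P: group "G\<lparr>carrier := P\<rparr>"
    using assms(1) subgroup_imp_group by blast
  show ?thesis
    using P.pow_order_eq_1[of g] assms(2) nat_pow_consistent[of g "card P" P]
    by (simp add: order_def)
qed

lemma (in group) conjugate_nat_pow_iterate:
  fixes j :: int
  assumes c: "c \<in> carrier G" and x: "x \<in> carrier G" and j: "c \<otimes> x \<otimes> inv c = x [^] j"
  shows "c [^] (k :: nat) \<otimes> x \<otimes> inv (c [^] k) = x [^] (j ^ k)"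
proof (induction k)
  case 0
  show ?case using x by simp
next
  case (Suc k)
  have "c [^] Suc k \<otimes> x \<otimes> inv (c [^] Suc k) = c \<otimes> (c [^] k \<otimes> x \<otimes> inv (c [^] k)) \<otimes> inv c"
    unfolding nat_pow_Suc2[OF c] using c x by (simp add: inv_mult_group m_assoc)
  also have "\<dots> = (c \<otimes> x \<otimes> inv c) [^] (j ^ k)"
    using c x by (simp add: Suc conjugate_int_pow)
  also have "\<dots> = x [^] (j ^ Suc k)"
    using x by (simp add: j int_pow_pow)
  finally show ?case .
qed

text \<open>Fermat's little theorem in the form \<open>j ^ p \<equiv> j\<close>, which also holds
  for multiples of \<open>p\<close>, iterated \<open>a\<close> times.\<close>

lemma prime_dvd_power_minus_self:
  fixes j :: int
  assumes "prime p"
  shows "int p dvd j ^ (p ^ a) - j"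
proof -
  have *: "[i ^ p = i] (mod int p)" for i :: int
  proof -
    define n where "n = nat (i mod int p)"
    have "[n ^ p = n] (mod p)"
    proof (cases "p dvd n")
      case True
      then have "p dvd n ^ p"
        using dvd_power_same[OF True, of p] prime_gt_0_nat[OF assms] dvd_power dvd_trans by blast
      then show ?thesis
        using True by (simp add: cong_def)
    next
      case False
      then have "[n ^ (p - 1) * n = 1 * n] (mod p)"
        by (intro cong_scalar_right fermat_theorem[OF assms])
      then show ?thesis
        by (simp only: power_minus_mult[OF prime_gt_0_nat[OF assms]] mult_1)
    qed
    then have "[int n ^ p = int n] (mod int p)"
      by (metis cong_int_iff of_nat_power)
    moreover have "int n = i mod int p"
      using prime_gt_0_nat[OF assms] by (simp add: n_def)
    ultimately have "[(i mod int p) ^ p = i mod int p] (mod int p)"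
      by simp
    then show ?thesis
      by (simp add: cong_def power_mod)
  qed
  have "[j ^ (p ^ a) = j] (mod int p)"
  proof (induction a)
    case (Suc a)
    have "[(j ^ (p ^ a)) ^ p = j] (mod int p)"
      using cong_trans[OF * Suc] .
    then show ?case by (simp add: mult.commute flip: power_mult)
  qed simp
  then show ?thesis by (simp add: cong_iff_dvd_diff)
qed

text \<open>Conjugating \<open>p ^ a\<close> times is trivial, so \<open>j ^ (p ^ a)\<close> is 1
  modulo \<open>p\<close>; by Fermat it is also \<open>j\<close> modulo \<open>p\<close>.\<close>

lemma (in group) p_element_centralizes_order_p:
  fixes j :: int
  assumes p: "prime p" and c: "c \<in> carrier G" and x: "x \<in> carrier G" and ord: "ord x = p"
    and j: "c \<otimes> x \<otimes> inv c = x [^] j" and "c [^] (p ^ a :: nat) = \<one>"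
  shows "x [^] (j - 1) = \<one>"
proof -
  have "x [^] (j ^ (p ^ a)) = x [^] (1 :: int)"
    using conjugate_nat_pow_iterate[OF c x j, of "p ^ a"] assms(6) x by simp
  then have "int p dvd 1 - j ^ (p ^ a)"
    using int_pow_eq[OF x] ord by simp
  then have "int p dvd (1 - j ^ (p ^ a)) + (j ^ (p ^ a) - j)"
    using prime_dvd_power_minus_self[OF p] by (rule dvd_add)
  then have "int p dvd j - 1"
    by (simp add: dvd_diff_commute)
  then show ?thesis
    using int_pow_eq_id[OF x] ord by simp
qed

text \<open>Supplies a nontrivial central element of \<open>G / K\<close>, the step by which the
  upper central series grows. An \<open>x\<close> in \<open>L\<close> of prime order modulo
  \<open>A = L \<inter> K\<close> is centralized modulo \<open>A\<close> by every normal Sylow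
  subgroup, hence by \<open>G\<close>.\<close>

lemma (in group) normal_sylow_central_modulo:
  assumes fin: "finite (carrier G)" and sups: "supersolvable_group G"
    and sylow: "\<And>p. prime p \<Longrightarrow> \<exists>P. P \<lhd> G \<and> card P = p ^ multiplicity p (order G)"
    and K: "K \<lhd> G" "K \<noteq> carrier G"
  shows "\<exists>x\<in>carrier G. x \<notin> K \<and> (\<forall>g\<in>carrier G. K #> (x \<otimes> g) = K #> (g \<otimes> x))"
proof -
  interpret K: normal K G by fact
  obtain N L where NL: "cyclic_section G N L" "N \<subseteq> K" "\<not> L \<subseteq> K"
    using K K.subgroup_axioms sups supersolvable_section by blast
  interpret cyclic_section G N L by fact
  define A where "A = L \<inter> K"
  interpret A: normal A G
    using intersection[OF K.subgroup_axioms NL(2)] unfolding A_def .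
  interpret Q: group_hom G "G Mod A" "(#>) A" by (rule A.r_coset_group_hom)
  have NA: "N \<subseteq> A" using bottom_subset_top NL by (auto simp: A_def)
  have "\<not> L \<subseteq> A" using NL by (auto simp: A_def)
  then obtain p :: nat and x where p: "prime p" and x: "x \<in> L" "x \<notin> A" "x [^] p \<in> A"
    using A.exists_prime_order_modulo[OF fin L.subgroup_axioms] by blast
  have xc: "x \<in> carrier G" using x by simp
  define X where "X = A #> x"
  have X: "X \<in> carrier (G Mod A)" unfolding X_def by (rule Q.hom_closed[OF xc])
  have "X [^]\<^bsub>G Mod A\<^esub> p = \<one>\<^bsub>G Mod A\<^esub>"
    using A.r_coset_eq_self_iff[of "x [^] p"] x xc by (simp add: X_def flip: Q.hom_nat_pow)
  then have "Q.H.ord X dvd p"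
    using Q.H.pow_eq_id[OF X] by blast
  moreover have "Q.H.ord X \<noteq> 1"
    using Q.H.ord_eq_1[OF X] A.r_coset_eq_self_iff[OF xc] x(2) by (simp add: X_def)
  ultimately have ordX: "Q.H.ord X = p"
    using p by (auto simp: prime_nat_iff)
  define C where "C = centralizer_modulo A {x}"
  have C: "subgroup C G"
    unfolding C_def using xc A.normal_axioms by (intro subgroup_centralizer_modulo) auto
  have PC: "P \<subseteq> C" if q: "prime q" and P: "P \<lhd> G" "card P = q ^ a" for q P and a :: nat
  proof
    fix g assume g: "g \<in> P"
    interpret P: normal P G by fact
    have gc: "g \<in> carrier G" using g by simp
    \<comment> \<open>In \<open>G Mod A\<close> conjugation by \<open>g\<close> sends
      \<open>X\<close> to its \<open>j\<close>-th power, so it remains to see that the power of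
      \<open>X\<close> to \<open>j - 1\<close> is trivial.\<close>
    obtain j :: int where "N #> (g \<otimes> x \<otimes> inv g) = N #> (x [^] j)"
      using conj_eq_power[OF gc] x(1) by blast
    then have j: "A #> (g \<otimes> x \<otimes> inv g) = A #> (x [^] j)"
      using gc xc by (intro r_coset_mono[OF N.subgroup_axioms A.subgroup_axioms NA]) auto
    define c where "c = A #> g"
    have c: "c \<in> carrier (G Mod A)" unfolding c_def by (rule Q.hom_closed[OF gc])
    have cj: "c \<otimes>\<^bsub>G Mod A\<^esub> X \<otimes>\<^bsub>G Mod A\<^esub> inv\<^bsub>G Mod A\<^esub> c = X [^]\<^bsub>G Mod A\<^esub> j"
      using j unfolding c_def X_def
      by (simp only: Q.hom_mult Q.hom_inv Q.hom_int_pow gc xc m_closed inv_closed)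
    have "X [^]\<^bsub>G Mod A\<^esub> (j - 1) = \<one>\<^bsub>G Mod A\<^esub>"
    proof (cases "q = p")
      case True
      have "c [^]\<^bsub>G Mod A\<^esub> (p ^ a) = \<one>\<^bsub>G Mod A\<^esub>"
        using subgroup_pow_card[OF P.subgroup_axioms g] P(2) True gc
        by (simp add: c_def flip: Q.hom_nat_pow)
      then show ?thesis
        by (rule Q.H.p_element_centralizes_order_p[OF p c X ordX cj])
    next
      case False
      \<comment> \<open>The commutator of \<open>g\<close> and \<open>x\<close>, bracketed to show
        that it lies in the normal subgroup \<open>P\<close>. Its image has order dividing
        \<open>q ^ a\<close>; being a power of \<open>X\<close>, it also has order dividing
        \<open>p\<close>.\<close>
      define u where "u = g \<otimes> (x \<otimes> inv g \<otimes> inv x)"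
      have "u \<in> P"
        using g xc P.inv_op_closed2 by (simp add: u_def)
      define U where "U = A #> u"
      have uc: "u \<in> carrier G" using \<open>u \<in> P\<close> by simp
      have U: "U \<in> carrier (G Mod A)" unfolding U_def by (rule Q.hom_closed[OF uc])
      have "U [^]\<^bsub>G Mod A\<^esub> (q ^ a) = \<one>\<^bsub>G Mod A\<^esub>"
        using subgroup_pow_card[OF P.subgroup_axioms \<open>u \<in> P\<close>] P(2) uc
        by (simp add: U_def flip: Q.hom_nat_pow)
      then have "Q.H.ord U dvd q ^ a"
        using Q.H.pow_eq_id[OF U] by blast
      have "u = (g \<otimes> x \<otimes> inv g) \<otimes> inv x"
        using gc xc by (simp add: u_def m_assoc)
      then have "U = (A #> (g \<otimes> x \<otimes> inv g)) \<otimes>\<^bsub>G Mod A\<^esub> inv\<^bsub>G Mod A\<^esub> X"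
        unfolding U_def X_def by (simp only: Q.hom_mult Q.hom_inv gc xc m_closed inv_closed)
      then have UX: "U = X [^]\<^bsub>G Mod A\<^esub> (j - 1)"
        by (simp only: j Q.H.int_pow_diff[OF X] Q.hom_int_pow[OF xc] Q.H.int_pow_1[OF X] flip: X_def)
      then have "U [^]\<^bsub>G Mod A\<^esub> int p = \<one>\<^bsub>G Mod A\<^esub>"
        using X ordX Q.H.int_pow_eq_id[OF X] by (simp add: Q.H.int_pow_pow)
      then have "Q.H.ord U dvd p"
        using Q.H.int_pow_eq_id[OF U] by simp
      moreover have "coprime (q ^ a) p"
        using False p q primes_coprime by (simp add: primes_coprime)
      ultimately have "Q.H.ord U = 1"
        using \<open>Q.H.ord U dvd q ^ a\<close> coprime_common_divisor_nat by blast
      then show ?thesis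
        using Q.H.ord_eq_1[OF U] UX by simp
    qed
    then have "X [^]\<^bsub>G Mod A\<^esub> j = X [^]\<^bsub>G Mod A\<^esub> (1 :: int)"
      using Q.H.int_pow_eq_id[OF X] Q.H.int_pow_eq[OF X] by (simp add: dvd_diff_commute)
    then have "A #> (g \<otimes> x \<otimes> inv g) = A #> x"
      using j xc X by (simp add: X_def Q.hom_int_pow)
    then have "A #> (\<one> \<otimes> (g \<otimes> x \<otimes> inv g) \<otimes> g) = A #> (\<one> \<otimes> x \<otimes> g)"
      using gc xc by (intro A.r_coset_mult_cong) auto
    then have "A #> (g \<otimes> x) = A #> (x \<otimes> g)"
      using gc xc by (simp add: m_assoc)
    then show "g \<in> C"
      using gc by (simp add: C_def centralizer_modulo_def)
  qed
  \<comment> \<open>Checked prime by prime: \<open>C\<close> contains a Sylow subgroup for each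
    \<open>q\<close>.\<close>
  have "order G dvd card C"
  proof (rule multiplicity_le_imp_dvd)
    show "order G \<noteq> 0" using fin order_gt_0_iff_finite by simp
    fix q :: nat assume q: "prime q"
    then obtain P where P: "P \<lhd> G" "card P = q ^ multiplicity q (order G)"
      using sylow by blast
    interpret P: normal P G by fact
    have dvd: "card P dvd card C"
      using card_subgroup_dvd[OF P.subgroup_axioms C PC[OF q P]] .
    have "card C \<noteq> 0"
      using finite_subset[OF subgroup.subset[OF C] fin] subgroup.one_closed[OF C] by auto
    then show "multiplicity q (order G) \<le> multiplicity q (card C)"
      using dvd P(2) prime_gt_1_nat[OF q] by (intro multiplicity_geI) auto
  qed
  then have "C = carrier G"
    using card_seteq[OF fin subgroup.subset[OF C]] finite_subset[OF subgroup.subset[OF C] fin]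
      subgroup.one_closed[OF C]
    by (auto simp: order_def card_gt_0_iff dest!: dvd_imp_le)
  show ?thesis
  proof (intro bexI[OF _ xc] conjI ballI)
    show "x \<notin> K" using x by (simp add: A_def)
    fix g assume g: "g \<in> carrier G"
    then have "A #> (x \<otimes> g) = A #> (g \<otimes> x)"
      using \<open>C = carrier G\<close> unfolding C_def centralizer_modulo_def by auto
    then show "K #> (x \<otimes> g) = K #> (g \<otimes> x)"
      using g xc by (intro r_coset_mono[OF A.subgroup_axioms K.subgroup_axioms]) (auto simp: A_def)
  qed
qed

section \<open>Nilpotent groups have no normal 2-covering\<close>

text \<open>Where the central series leaves \<open>M\<close>, it yields an \<open>x\<close> outside
  \<open>M\<close> that is central modulo a subgroup of \<open>M\<close>; this \<open>x\<close>
  normalizes \<open>M\<close>.\<close>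

lemma (in group) nilpotent_maximal_subgroup_normal:
  assumes fin: "finite (carrier G)" and nil: "nilpotent_group G" and max: "maximal_subgroup M G"
  shows "M \<lhd> G"
proof -
  have M: "subgroup M G" "M \<noteq> carrier G"
    using max by (auto simp: maximal_subgroup_def)
  interpret M: subgroup M G by fact
  obtain n N where N: "N 0 = {\<one>}" "N n = carrier G" "\<forall>i\<le>n. N i \<lhd> G"
    "\<forall>i<n. N i \<subseteq> N (Suc i) \<and>
       carrier ((G\<lparr>carrier := N (Suc i)\<rparr>) Mod N i) \<subseteq> group_center (G Mod N i)"
    using nil by (auto simp: nilpotent_group_def)
  have "N 0 \<subseteq> M" "\<not> N n \<subseteq> M"
    using N(1,2) M(2) M.one_closed M.subset by auto
  then obtain i where i: "i < n" "N i \<subseteq> M" "\<not> N (Suc i) \<subseteq> M"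
    by (rule exists_first_step_outside)
  then obtain x where x: "x \<in> N (Suc i)" "x \<notin> M" by blast
  interpret Ni: normal "N i" G using N(3) i(1) by simp
  have xc: "x \<in> carrier G"
    using N(3) i(1) x(1) normal_imp_subgroup subgroup.mem_carrier by (metis Suc_leI)
  have "N i #> x \<in> carrier ((G\<lparr>carrier := N (Suc i)\<rparr>) Mod N i)"
    using x(1) by (auto simp: carrier_FactGroup)
  then have central: "N i #> x \<in> group_center (G Mod N i)"
    using N(4) i(1) by blast
  have "x \<otimes> m \<otimes> inv x \<in> M" if m: "m \<in> M" for m
  proof -
    have "N i #> m \<in> carrier (G Mod N i)"
      using m by (auto simp: carrier_FactGroup)
    then have "(N i #> x) <#> (N i #> m) = (N i #> m) <#> (N i #> x)"
      using central by (simp add: group_center_def)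
    then have "N i #> (x \<otimes> m) = N i #> (m \<otimes> x)"
      using m xc by (simp add: Ni.rcos_sum)
    then show ?thesis
      using Ni.conjugate_mem_if_commute_modulo[OF M(1) i(2) xc m] by blast
  qed
  then have "x \<in> normalizer G M"
    using mem_normalizerI[OF M.subset finite_subset[OF M.subset fin] xc] by blast
  then show ?thesis
    using maximal_subgroup_normal[OF fin max] x(2) by blast
qed

text \<open>If the union were everything, \<open>a\<close> outside \<open>H\<close> would lie in
  \<open>K\<close> and \<open>b\<close> outside \<open>K\<close> in \<open>H\<close>, and
  \<open>a \<otimes> b\<close> could lie in neither.\<close>

lemma (in group) union_of_two_proper_subgroups:
  assumes "subgroup H G" "H \<noteq> carrier G" "subgroup K G" "K \<noteq> carrier G"
  shows "\<exists>x\<in>carrier G. x \<notin> H \<and> x \<notin> K"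
proof (rule ccontr)
  assume neg: "\<not> ?thesis"
  interpret H: subgroup H G by fact
  interpret K: subgroup K G by fact
  obtain a b where a: "a \<in> carrier G" "a \<notin> H" and b: "b \<in> carrier G" "b \<notin> K"
    using assms(2,4) H.subset K.subset by blast
  have "a \<in> K" "b \<in> H" using a b neg by auto
  have "a \<otimes> b \<in> carrier G" using a b by simp
  then consider "a \<otimes> b \<in> H" | "a \<otimes> b \<in> K" using neg by auto
  then show False
  proof cases
    case 1
    then have "a \<otimes> b \<otimes> inv b \<in> H" using \<open>b \<in> H\<close> by blast
    then show False using a b by (simp add: m_assoc)
  next
    case 2
    then have "inv a \<otimes> (a \<otimes> b) \<in> K" using \<open>a \<in> K\<close> by blast
    then show False using a b by simp
  qed
qed

lemma (in group) nilpotent_not_covered_by_two_conjugacy_classes: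
  assumes fin: "finite (carrier G)" and nil: "nilpotent_group G"
    and H: "subgroup H G" "H \<noteq> carrier G" and K: "subgroup K G" "K \<noteq> carrier G"
  shows "\<exists>x\<in>carrier G. \<forall>g\<in>carrier G. x \<notin> conjugate_subgroup G H g \<and> x \<notin> conjugate_subgroup G K g"
proof -
  \<comment> \<open>A maximal subgroup above \<open>H\<close> is normal, so it absorbs all
    conjugates of \<open>H\<close>.\<close>
  have avoid: "\<exists>M. subgroup M G \<and> M \<noteq> carrier G \<and>
      (\<forall>g\<in>carrier G. conjugate_subgroup G H g \<subseteq> M)" if H: "subgroup H G" "H \<noteq> carrier G" for H
  proof -
    obtain M where M: "maximal_subgroup M G" "H \<subseteq> M"
      using exists_maximal_subgroup[OF fin H] .
    interpret M: normal M G
      using nilpotent_maximal_subgroup_normal[OF fin nil M(1)] .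
    have "conjugate_subgroup G H g \<subseteq> M" if g: "g \<in> carrier G" for g
    proof
      fix x assume "x \<in> conjugate_subgroup G H g"
      then have "x \<in> carrier G" "inv g \<otimes> (g \<otimes> x \<otimes> inv g) \<otimes> g \<in> M"
        using mem_conjugate_subgroup[OF subgroup.subset[OF H(1)] g] M(2) M.inv_op_closed1[OF g]
        by auto
      then show "x \<in> M" using g by (simp add: m_assoc)
    qed
    then show ?thesis
      using M.subgroup_axioms M(1) unfolding maximal_subgroup_def by blast
  qed
  obtain M M' where M: "subgroup M G" "M \<noteq> carrier G" "\<forall>g\<in>carrier G. conjugate_subgroup G H g \<subseteq> M"
    and M': "subgroup M' G" "M' \<noteq> carrier G" "\<forall>g\<in>carrier G. conjugate_subgroup G K g \<subseteq> M'"
    using avoid[OF H] avoid[OF K] by metis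
  then show ?thesis
    using union_of_two_proper_subgroups[OF M(1,2) M'(1,2)] by (meson subsetD)
qed

section \<open>Nilpotency when all maximal subgroups are normal\<close>

text \<open>A proper normalizer of a Sylow subgroup would lie in a maximal subgroup, normal by
  assumption, against the Frattini argument.\<close>

lemma (in group) normal_sylow_if_maximal_normal:
  assumes fin: "finite (carrier G)" and max: "\<And>M. maximal_subgroup M G \<Longrightarrow> M \<lhd> G"
    and p: "prime p"
  shows "\<exists>P. P \<lhd> G \<and> card P = p ^ multiplicity p (order G)"
proof -
  obtain m where "order G = p ^ multiplicity p (order G) * m"
    using multiplicity_dvd by blast
  then obtain P where P: "subgroup P G" "card P = p ^ multiplicity p (order G)"
    using sylow_thm[OF p group_axioms _ fin] by blast
  have "normalizer G P = carrier G"
  proof (rule ccontr)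
    assume "normalizer G P \<noteq> carrier G"
    then obtain M where M: "maximal_subgroup M G" "normalizer G P \<subseteq> M"
      by (rule exists_maximal_subgroup[OF fin normalizer_imp_subgroup[OF subgroup.subset[OF P(1)]]])
    then have "M = carrier G"
      using frattini_argument[OF fin p P max] by blast
    then show False using M(1) by (simp add: maximal_subgroup_def)
  qed
  then have "P \<lhd> G"
    using normal_iff_normalizer[OF P(1) finite_subset[OF subgroup.subset[OF P(1)] fin]] by blast
  then show ?thesis using P(2) by blast
qed

text \<open>This is the preimage of the center of \<open>G Mod H\<close>: an element central modulo
  \<open>H\<close> has the same coset as its conjugates, and membership depends only on the
  coset.\<close>

lemma (in normal) centralizer_modulo_carrier_normal: "centralizer_modulo H (carrier G) \<lhd> G"
proof (rule normal_invI)
  show "subgroup (centralizer_modulo H (carrier G)) G"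
    by (rule subgroup_centralizer_modulo[OF normal_axioms]) simp
  fix g z assume g: "g \<in> carrier G" and z: "z \<in> centralizer_modulo H (carrier G)"
  then have zc: "z \<in> carrier G" by (simp add: centralizer_modulo_def)
  define w where "w = g \<otimes> z \<otimes> inv g"
  have wc: "w \<in> carrier G" using g zc by (simp add: w_def)
  have "H #> (\<one> \<otimes> (g \<otimes> z) \<otimes> inv g) = H #> (\<one> \<otimes> (z \<otimes> g) \<otimes> inv g)"
    using g z zc by (intro r_coset_mult_cong) (auto simp: centralizer_modulo_def)
  then have w: "H #> w = H #> z"
    using g zc by (simp add: w_def m_assoc)
  have "H #> (w \<otimes> s) = H #> (s \<otimes> w)" if s: "s \<in> carrier G" for s
  proof -
    have "H #> (w \<otimes> s) = H #> (z \<otimes> s)"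
      using w s wc zc by (simp flip: rcos_sum)
    also have "\<dots> = H #> (s \<otimes> z)"
      using z s by (simp add: centralizer_modulo_def)
    also have "\<dots> = H #> (s \<otimes> w)"
      using w s wc zc by (simp flip: rcos_sum)
    finally show ?thesis .
  qed
  then show "g \<otimes> z \<otimes> inv g \<in> centralizer_modulo H (carrier G)"
    using wc by (simp add: centralizer_modulo_def flip: w_def)
qed

lemma (in group) nilpotent_if_maximal_normal:
  assumes fin: "finite (carrier G)" and sups: "supersolvable_group G"
    and max: "\<And>M. maximal_subgroup M G \<Longrightarrow> M \<lhd> G"
  shows "nilpotent_group G"
proof -
  \<comment> \<open>The upper central series, which will witness nilpotency.\<close>
  define Z where "Z n = ((\<lambda>K. centralizer_modulo K (carrier G)) ^^ n) {\<one>}" for n :: nat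
  have Z0: "Z 0 = {\<one>}" and ZSuc: "Z (Suc n) = centralizer_modulo (Z n) (carrier G)" for n
    by (simp_all add: Z_def)
  have Zn: "Z n \<lhd> G" for n
    by (induction n) (simp_all add: Z0 ZSuc one_is_normal normal.centralizer_modulo_carrier_normal)
  have mono: "Z n \<subseteq> Z (Suc n)" for n
    using normal.subset_centralizer_modulo[OF Zn] by (simp add: ZSuc)
  have Zsub: "Z n \<subseteq> carrier G" for n
    using Zn normal_imp_subgroup subgroup.subset by blast
  have strict: "Z n \<noteq> Z (Suc n)" if ne: "Z n \<noteq> carrier G" for n
  proof -
    have sylow: "\<exists>P. P \<lhd> G \<and> card P = p ^ multiplicity p (order G)" if "prime p" for p
      using normal_sylow_if_maximal_normal[OF fin _ that] max by blast
    obtain x where "x \<in> carrier G" "x \<notin> Z n" "\<forall>g\<in>carrier G. Z n #> (x \<otimes> g) = Z n #> (g \<otimes> x)"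
      using normal_sylow_central_modulo[OF fin sups sylow Zn ne] by blast
    then have "x \<in> Z (Suc n)" "x \<notin> Z n" by (auto simp: ZSuc centralizer_modulo_def)
    then show ?thesis by blast
  qed
  have "\<exists>n. Z n = carrier G"
  proof (rule ccontr)
    assume never: "\<not> ?thesis"
    \<comment> \<open>Strict growth at every step would push \<open>card (Z n)\<close> beyond
      \<open>card (carrier G)\<close>.\<close>
    have "n \<le> card (Z n)" for n
    proof (induction n)
      case (Suc n)
      have "card (Z n) < card (Z (Suc n))"
        using strict never mono finite_subset[OF Zsub fin] by (intro psubset_card_mono) auto
      then show ?case using Suc by simp
    qed simp
    then have "Suc (card (carrier G)) \<le> card (Z (Suc (card (carrier G))))" .
    also have "\<dots> \<le> card (carrier G)"
      using card_mono[OF fin Zsub] .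
    finally show False by simp
  qed
  then obtain n where "Z n = carrier G" by blast
  moreover have "carrier ((G\<lparr>carrier := Z (Suc i)\<rparr>) Mod Z i) \<subseteq> group_center (G Mod Z i)" for i
  proof
    fix X assume "X \<in> carrier ((G\<lparr>carrier := Z (Suc i)\<rparr>) Mod Z i)"
    then obtain z where z: "z \<in> Z (Suc i)" "X = Z i #> z"
      by (auto simp: carrier_FactGroup)
    interpret Zi: normal "Z i" G by (rule Zn)
    have zc: "z \<in> carrier G" using z Zsub by blast
    then show "X \<in> group_center (G Mod Z i)"
      using z by (auto simp: group_center_def carrier_FactGroup Zi.rcos_sum ZSuc centralizer_modulo_def)
  qed
  ultimately show ?thesis
    unfolding nilpotent_group_def using Z0 Zn mono by (intro exI[of _ n] exI[of _ Z]) blast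
qed

section \<open>The normal covering number and coverings of length 2\<close>

text \<open>A finite infimum in \<open>enat\<close> is attained, which gives one direction. For the
  other, length 0 fails because the union is empty, and length 1 by the Jordan argument.\<close>

lemma (in group) supersolvable_normal_covering_number_eq_2_iff:
  assumes "supersolvable_group G"
  shows "normal_covering_number G = 2 \<longleftrightarrow> (\<exists>H. normal_covering G 2 H)"
proof
  let ?S = "{enat k | k. \<exists>H. normal_covering G k H}"
  have two: "(2 :: enat) = enat 2" by (simp add: numeral_eq_enat)
  {
    assume "normal_covering_number G = 2"
    then have Inf: "Inf ?S = enat 2"
      by (simp add: normal_covering_number_def two)
    have "?S \<noteq> {}"
    proof
      assume "?S = {}"
      then show False using Inf unfolding \<open>?S = {}\<close> by (simp add: Inf_enat_def)
    qed
    \<comment> \<open>On a nonempty set \<open>Inf\<close> is the least element; on the empty set it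
      would be infinite, as excluded above.\<close>
    then have "Inf ?S \<in> ?S"
      unfolding Inf_enat_def using LeastI[of "\<lambda>x. x \<in> ?S"] by (simp only: if_False) blast
    then show "\<exists>H. normal_covering G 2 H"
      unfolding Inf by auto
  next
    assume two_cover: "\<exists>H. normal_covering G 2 H"
    have "2 \<le> k" if cover: "normal_covering G k H" for k H
    proof -
      have "k \<noteq> 0"
        using cover by (auto simp: normal_covering_def)
      moreover have "k \<noteq> 1"
      proof
        assume "k = 1"
        then have "subgroup (H 1) G" "H 1 \<noteq> carrier G"
          "carrier G = (\<Union>g\<in>carrier G. conjugate_subgroup G (H 1) g)"
          using cover by (simp_all add: normal_covering_def)
        then show False
          using supersolvable_not_covered_by_conjugates[OF assms, of "H 1"] by blast
      qed
      ultimately show ?thesis by simp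
    qed
    then have "enat 2 \<le> Inf ?S"
      by (intro Inf_greatest) auto
    moreover have "Inf ?S \<le> enat 2"
      using two_cover by (intro Inf_lower) auto
    ultimately show "normal_covering_number G = 2"
      by (simp add: normal_covering_number_def two)
  }
qed

theorem theorem1p2:
  fixes G (structure)
  assumes "group G" and "finite (carrier G)" and "supersolvable_group G"
  shows "normal_covering_number G \<noteq> 2 \<longleftrightarrow> nilpotent_group G"
proof -
  interpret group G by fact
  have two: "{1..2 :: nat} = {1, 2}" by auto
  have "(\<exists>H. normal_covering G 2 H) \<longleftrightarrow> \<not> nilpotent_group G"
  proof
    assume "\<exists>H. normal_covering G 2 H"
    then obtain H where "normal_covering G 2 H" by blast
    then have H: "subgroup (H 1) G" "H 1 \<noteq> carrier G" "subgroup (H 2) G" "H 2 \<noteq> carrier G"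
      "carrier G = (\<Union>g\<in>carrier G. conjugate_subgroup G (H 1) g) \<union>
        (\<Union>g\<in>carrier G. conjugate_subgroup G (H 2) g)"
      unfolding normal_covering_def two by simp_all
    show "\<not> nilpotent_group G"
    proof
      assume "nilpotent_group G"
      then obtain x where "x \<in> carrier G"
        "\<forall>g\<in>carrier G. x \<notin> conjugate_subgroup G (H 1) g \<and> x \<notin> conjugate_subgroup G (H 2) g"
        using nilpotent_not_covered_by_two_conjugacy_classes[OF assms(2) _ H(1-4)] by blast
      then show False using H(5) by blast
    qed
  next
    assume "\<not> nilpotent_group G"
    then obtain M where M: "maximal_subgroup M G" "\<not> M \<lhd> G"
      using nilpotent_if_maximal_normal[OF assms(2,3)] by blast
    then have M': "subgroup M G" "M \<noteq> carrier G"
      by (auto simp: maximal_subgroup_def)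
    obtain C where C: "subgroup C G" "C \<noteq> carrier G"
      "\<forall>g\<in>carrier G. g \<in> C \<or> (\<exists>y\<in>carrier G. y \<otimes> g \<otimes> inv y \<in> M)"
      using nonnormal_maximal_subgroup_covers[OF assms(2,3) M] by blast
    define H where "H i = (if i = (1 :: nat) then C else M)" for i
    have mem: "x \<in> conjugate_subgroup G K g \<longleftrightarrow> x \<in> carrier G \<and> g \<otimes> x \<otimes> inv g \<in> K"
      if "subgroup K G" "g \<in> carrier G" for K x g
      using mem_conjugate_subgroup[OF subgroup.subset[OF that(1)] that(2)] .
    \<comment> \<open>Elements of \<open>C\<close> are covered with conjugator
      \<open>\<one>\<close>, all others by the conjugate of \<open>M\<close> under the given
      \<open>y\<close>.\<close>
    have "carrier G = (\<Union>g\<in>carrier G. conjugate_subgroup G C g) \<union>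
        (\<Union>g\<in>carrier G. conjugate_subgroup G M g)" (is "_ = ?U")
    proof
      show "?U \<subseteq> carrier G" using mem C(1) M'(1) by auto
      show "carrier G \<subseteq> ?U"
      proof
        fix x assume x: "x \<in> carrier G"
        then consider "x \<in> C" | y where "y \<in> carrier G" "y \<otimes> x \<otimes> inv y \<in> M"
          using C(3) by blast
        then show "x \<in> ?U"
        proof cases
          case 1
          then have "x \<in> conjugate_subgroup G C \<one>" using mem[OF C(1)] x by simp
          then show ?thesis by blast
        next
          case 2
          then have "x \<in> conjugate_subgroup G M y" using mem[OF M'(1)] x by simp
          then show ?thesis using 2(1) by blast
        qed
      qed
    qed
    then have "normal_covering G 2 H"
      unfolding normal_covering_def two using C M' by (simp add: H_def)
    then show "\<exists>H. normal_covering G 2 H" by blast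
  qed
  then show ?thesis
    using supersolvable_normal_covering_number_eq_2_iff[OF assms(3)] by blast
qed

end
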